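(* Let $n$ be a natural number of the form $n=3k+\ell$ with integers $k\ge 0$ and $0\leq \ell\le 2$. Then the maximum number of rational $3$-term sums in $n$-element sets of irrational numbers is $$\mathrm{h}(n,3)=k\cdot \binom{2k+\ell}{2}.$$
   Context: For a finite set $A$ of irrational real numbers and an integer $r>1$, let $\mathcal{H}(A,r)$ denote the set of $r$-element subsets $A'\subseteq A$ for which $\sum_{x\in A'} x\in \mathbb{Q}$. Define $\mathrm{h}(n,r):=\max_{A} |\mathcal{H}(A,r)|$, the maximum being over all sets $A$ of $n$ (distinct) irrational real numbers. *)

theory Defs
  imports Complex_Main
begin

definition rational_sums :: "real set \<Rightarrow> nat \<Rightarrow> real set set" where
  "rational_sums A r = {A'. A' \<subseteq> A \<and> card A' = r \<and> (\<Sum>x\<in>A'. x) \<in> \<rat>}"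

definition irrational_sets :: "nat \<Rightarrow> real set set" where
  "irrational_sets n = {A. finite A \<and> card A = n \<and> A \<inter> \<rat> = {}}"

text \<open>The maximum is attained: by the two lemmas below it is taken over a finite nonempty set.\<close>

definition h :: "nat \<Rightarrow> nat \<Rightarrow> nat" where
  "h n r = Max ((\<lambda>A. card (rational_sums A r)) ` irrational_sets n)"

lemma finite_card_rational_sums:
  "finite ((\<lambda>A. card (rational_sums A r)) ` irrational_sets n)"
proof (rule finite_subset)
  show "(\<lambda>A. card (rational_sums A r)) ` irrational_sets n \<subseteq> {..2 ^ n}"
  proof (rule image_subsetI)
    fix A assume A: "A \<in> irrational_sets n"
    have "card (rational_sums A r) \<le> card (Pow A)"
      using A by (intro card_mono) (auto simp: irrational_sets_def rational_sums_def)
    then show "card (rational_sums A r) \<in> {..2 ^ n}"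
      using A by (simp add: irrational_sets_def card_Pow)
  qed
qed simp

lemma irrational_sets_nonempty: "irrational_sets n \<noteq> {}"
proof -
  have irr: "real (Suc i) * sqrt 2 \<notin> \<rat>" for i
  proof
    assume "real (Suc i) * sqrt 2 \<in> \<rat>"
    then have "real (Suc i) * sqrt 2 / real (Suc i) \<in> \<rat>"
      by (intro Rats_divide Rats_of_nat)
    moreover have "real (Suc i) * sqrt 2 / real (Suc i) = sqrt 2"
      by (simp del: of_nat_Suc)
    ultimately have "sqrt 2 \<in> \<rat>" by metis
    then obtain m k :: nat where k: "k \<noteq> 0" "\<bar>sqrt 2\<bar> = real m / real k" "coprime m k"
      by (rule Rats_abs_nat_div_natE)
    then have "real m ^ 2 = (sqrt 2 * real k) ^ 2" by (simp add: field_simps)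
    then have "real (m ^ 2) = real (2 * k ^ 2)" by (simp add: power_mult_distrib)
    then have eq: "m ^ 2 = 2 * k ^ 2" by (simp only: of_nat_eq_iff)
    then have "even (m ^ 2)" by simp
    then have m: "even m" by simp
    then obtain j where "m = 2 * j" by (elim evenE)
    with eq have "k ^ 2 = 2 * j ^ 2" by (simp add: power_mult_distrib)
    then have "even (k ^ 2)" by simp
    then have "even k" by simp
    with m k(3) show False using coprime_common_divisor_nat[of m k 2] by simp
  qed
  have "inj_on (\<lambda>i. real (Suc i) * sqrt 2) {..<n}" by (auto simp: inj_on_def)
  then have "(\<lambda>i. real (Suc i) * sqrt 2) ` {..<n} \<in> irrational_sets n"
    using irr by (auto simp: irrational_sets_def card_image simp del: of_nat_Suc)
  then show ?thesis by blast
qed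

end

theory Submission
  imports Defs
begin

text \<open>
Call a triple of elements of \<open>A\<close> rational if its sum is. Only the classes of the elements modulo
the rationals matter, and the quotient of the reals by the rationals is torsion-free: no irrational
\<open>u\<close> has \<open>3 * u\<close> rational.

The lower bound comes from \<open>k\<close> elements in the class of \<open>-2 * a\<close> and \<open>n - k\<close> elements in the class
of an irrational \<open>a\<close> (\<open>exists_many_rational_triples\<close>): one element of the former and two of the
latter always have a rational sum.

The upper bound is an induction on \<open>n\<close>. With \<open>k = n div 3\<close>, the claimed maximum grows by
\<open>k * (n - 1 - k)\<close> from \<open>n - 1\<close> to \<open>n\<close> (\<open>choose_recurrence\<close>), so it is enough to delete a point that
lies in at most that many rational triples. To find one (\<open>exists_small_degree\<close>), let \<open>u\<close> belong to
a class \<open>U\<close> that has the most elements in \<open>A\<close>, let \<open>W\<close> be the class of \<open>-2 * u\<close>, and let \<open>S\<close>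
consist of the remaining elements. The size of \<open>U\<close> bounds the number of rational triples through
two given points, so if \<open>U\<close> is small (roughly, less than \<open>4/9\<close> of \<open>A\<close>) then every point has small
degree. If \<open>U\<close> is large, then the degrees are controlled by the sizes of \<open>U\<close>, \<open>W\<close> and \<open>S\<close>: a
point of \<open>U\<close> forms rational triples only with a pair from \<open>U \<times> W\<close> or a pair inside \<open>S\<close>, and a point
of \<open>W\<close> only with a pair inside \<open>U\<close> or a pair that meets \<open>S\<close> and avoids \<open>U\<close>. When \<open>U\<close> has about two
thirds of the elements or more, the points of \<open>U\<close> have small degree. When it has fewer, the degree
of \<open>u\<close> can be large only if \<open>S\<close> is tiny, and then the points of \<open>W\<close> have small degree. The
inequality \<open>degree_bounds_incompatible\<close> makes this precise, without any loss for small \<open>n\<close>.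
\<close>

section \<open>Triples through a point\<close>

definition coset :: "real set \<Rightarrow> real \<Rightarrow> real set" where
  "coset A c = {x \<in> A. x - c \<in> \<rat>}"

definition link :: "real set \<Rightarrow> real \<Rightarrow> real set set" where
  "link A v = {P. P \<subseteq> A - {v} \<and> card P = 2 \<and> v + \<Sum>P \<in> \<rat>}"

lemma finite_coset: "finite A \<Longrightarrow> finite (coset A c)"
  by (simp add: coset_def)

lemma finite_link: "finite A \<Longrightarrow> finite (link A v)"
  by (rule finite_subset[of _ "Pow A"]) (auto simp: link_def)

lemma link_pairE:
  assumes "P \<in> link A v"
  obtains x y where "P = {x, y}" "x \<noteq> y" "x \<in> A - {v}" "y \<in> A - {v}" "v + x + y \<in> \<rat>"
  using assms by (auto simp: link_def card_2_iff add.assoc)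

text \<open>The triples that contain \<open>v\<close> correspond to the pairs in the link of \<open>v\<close>, so the size of the link is
the degree of \<open>v\<close> in the hypergraph of rational triples.\<close>

lemma card_rational_sums_remove:
  assumes "finite A" "v \<in> A"
  shows "card (rational_sums A 3) = card (rational_sums (A - {v}) 3) + card (link A v)"
proof -
  have split: "rational_sums A 3 = rational_sums (A - {v}) 3 \<union> insert v ` link A v"
  proof (intro equalityI subsetI)
    fix T assume T: "T \<in> rational_sums A 3"
    then have finT: "finite T"
      using assms(1) by (auto simp: rational_sums_def intro: finite_subset)
    show "T \<in> rational_sums (A - {v}) 3 \<union> insert v ` link A v"
    proof (cases "v \<in> T")
      case True
      then have "T - {v} \<in> link A v"
        using T finT by (auto simp: link_def rational_sums_def sum.remove)
      moreover have "T = insert v (T - {v})" using True by blast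
      ultimately show ?thesis by blast
    qed (use T in \<open>auto simp: rational_sums_def\<close>)
  next
    fix T assume "T \<in> rational_sums (A - {v}) 3 \<union> insert v ` link A v"
    then show "T \<in> rational_sums A 3"
    proof
      assume "T \<in> insert v ` link A v"
      then obtain P where P: "P \<in> link A v" and T: "T = insert v P" by blast
      have "finite P" using P assms(1) by (auto simp: link_def intro: finite_subset)
      moreover have "v \<notin> P" using P by (auto simp: link_def)
      ultimately show ?thesis using P assms(2) by (auto simp: T link_def rational_sums_def)
    qed (auto simp: rational_sums_def)
  qed
  have "inj_on (insert v) (link A v)"
    by (rule inj_onI) (auto simp: link_def dest: insert_ident[THEN iffD1, rotated 2])
  moreover have "finite (rational_sums (A - {v}) 3)"
    by (rule finite_subset[of _ "Pow A"]) (use assms in \<open>auto simp: rational_sums_def\<close>)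
  moreover have "rational_sums (A - {v}) 3 \<inter> insert v ` link A v = {}"
    by (auto simp: rational_sums_def)
  ultimately show ?thesis
    unfolding split using finite_link[OF assms(1)]
    by (subst card_Un_disjoint) (auto simp: card_image)
qed

section \<open>Degree bounds from the cosets of the rationals\<close>

text \<open>Once \<open>v\<close> and a second point \<open>x\<close> of a rational triple are chosen, the third one is restricted to
the class of \<open>-v - x\<close>. Counting the pairs in the link of \<open>v\<close> by their elements \<open>x\<close> counts each of
them twice.\<close>

lemma card_link_le_max_coset:
  assumes A: "finite A" "v \<in> A"
    and M: "\<And>c. card (coset A c) \<le> M"
  shows "2 * card (link A v) \<le> (card A - 1) * M"
proof -
  have through: "card {P \<in> link A v. x \<in> P} \<le> M" for x
  proof -
    have "{P \<in> link A v. x \<in> P} \<subseteq> (\<lambda>y. {x, y}) ` coset A (- v - x)"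
    proof
      fix P assume P: "P \<in> {P \<in> link A v. x \<in> P}"
      then obtain a b where ab: "P = {a, b}" "a \<in> A - {v}" "b \<in> A - {v}" "v + a + b \<in> \<rat>"
        by (blast elim: link_pairE)
      from P ab(1) have "x = a \<or> x = b" by blast
      then obtain y where "P = {x, y}" "y \<in> A" "v + x + y \<in> \<rat>"
      proof
        assume "x = a"
        then show thesis using ab that[of b] by simp
      next
        assume "x = b"
        then show thesis using ab that[of a] by (simp add: ac_simps insert_commute)
      qed
      moreover from this have "y - (- v - x) \<in> \<rat>" by (simp add: algebra_simps)
      ultimately show "P \<in> (\<lambda>y. {x, y}) ` coset A (- v - x)"
        by (auto simp: coset_def)
    qed
    then have "card {P \<in> link A v. x \<in> P} \<le> card ((\<lambda>y. {x, y}) ` coset A (- v - x))"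
      by (intro card_mono finite_imageI finite_coset A)
    also have "\<dots> \<le> card (coset A (- v - x))"
      by (intro card_image_le finite_coset A)
    finally show ?thesis using M order_trans by blast
  qed
  have "(\<Sum>x\<in>A - {v}. card {P \<in> link A v. x \<in> P}) = 2 * card (link A v)"
  proof (rule sum_multicount)
    show "\<forall>P\<in>link A v. card {x \<in> A - {v}. x \<in> P} = 2"
    proof
      fix P assume "P \<in> link A v"
      then have "{x \<in> A - {v}. x \<in> P} = P" "card P = 2" by (auto simp: link_def)
      then show "card {x \<in> A - {v}. x \<in> P} = 2" by simp
    qed
  qed (use A finite_link in auto)
  moreover have "(\<Sum>x\<in>A - {v}. card {P \<in> link A v. x \<in> P}) \<le> card (A - {v}) * M"
    using sum_bounded_above[of "A - {v}" "\<lambda>x. card {P \<in> link A v. x \<in> P}" M] through by simp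
  ultimately show ?thesis using A by simp
qed

lemma card_pairs_between_le:
  assumes "finite X" "finite Y"
  shows "card ((\<lambda>(x, y). {x, y}) ` (X \<times> Y)) \<le> card X * card Y"
  using card_image_le[of "X \<times> Y"] assms by (simp add: card_cartesian_product)

context
  fixes A :: "real set" and u :: real
  assumes finA: "finite A" and irrational: "u \<notin> \<rat>"
begin

lemma three_mult_irrational: "3 * u \<notin> \<rat>"
proof
  assume "3 * u \<in> \<rat>"
  then have "3 * u / 3 \<in> \<rat>" by (intro Rats_divide) auto
  with irrational show False by simp
qed

text \<open>An element common to the classes of \<open>u\<close> and \<open>-2 * u\<close> would make the difference \<open>3 * u\<close> rational.\<close>

lemma coset_disjoint: "coset A u \<inter> coset A (- 2 * u) = {}"
proof -
  have False if "x - u \<in> \<rat>" "x - - 2 * u \<in> \<rat>" for x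
    using Rats_diff[OF that(2) that(1)] three_mult_irrational by simp
  then show ?thesis by (auto simp: coset_def)
qed

text \<open>Modulo the rationals, \<open>v = u\<close>, so a pair \<open>x, y\<close> in the link of \<open>v\<close> satisfies \<open>x + y = -u\<close>. Hence
one of them is \<open>u\<close> exactly if the other one is \<open>-2 * u\<close>, and otherwise both lie in \<open>S\<close>.\<close>

lemma card_link_le_same_coset:
  assumes v: "v \<in> coset A u"
  defines "W \<equiv> coset A (- 2 * u)"
  defines "S \<equiv> A - coset A u - W"
  shows "card (link A v) \<le> (card (coset A u) - 1) * card W + (card S choose 2)"
proof -
  let ?U = "coset A u"
  let ?UW = "(\<lambda>(x, y). {x, y}) ` ((?U - {v}) \<times> W)"
  let ?SS = "{P. P \<subseteq> S \<and> card P = 2}"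
  have fin: "finite ?U" "finite W" "finite S"
    using finA by (auto simp: W_def S_def coset_def)
  have partner: "(x \<in> ?U \<longrightarrow> y \<in> W) \<and> (x \<in> W \<longrightarrow> y \<in> ?U)"
    if "v + x + y \<in> \<rat>" "x \<in> A" "y \<in> A" for x y
  proof -
    have "v - u \<in> \<rat>" using v by (simp add: coset_def)
    with that(1) have q: "v + x + y - (v - u) \<in> \<rat>" by (rule Rats_diff)
    have "y - - 2 * u \<in> \<rat>" if "x - u \<in> \<rat>"
      using Rats_diff[OF q that] by (simp add: algebra_simps)
    moreover have "y - u \<in> \<rat>" if "x - - 2 * u \<in> \<rat>"
      using Rats_diff[OF q that] by (simp add: algebra_simps)
    ultimately show ?thesis using that by (auto simp: coset_def W_def)
  qed
  have "link A v \<subseteq> ?UW \<union> ?SS"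
  proof
    fix P assume "P \<in> link A v"
    then obtain x y where P: "P = {x, y}" "x \<noteq> y" "x \<in> A - {v}" "y \<in> A - {v}" "v + x + y \<in> \<rat>"
      by (rule link_pairE)
    have 1: "(x \<in> ?U \<longrightarrow> y \<in> W) \<and> (x \<in> W \<longrightarrow> y \<in> ?U)"
      using partner[of x y] P by auto
    have 2: "(y \<in> ?U \<longrightarrow> x \<in> W) \<and> (y \<in> W \<longrightarrow> x \<in> ?U)"
      using partner[of y x] P by (auto simp: ac_simps)
    consider "x \<in> ?U - {v}" "y \<in> W" | "y \<in> ?U - {v}" "x \<in> W" | "x \<in> S" "y \<in> S"
      using 1 2 P by (auto simp: S_def)
    then show "P \<in> ?UW \<union> ?SS"
    proof cases
      case 1
      then have "P \<in> ?UW" unfolding P(1) by (intro image_eqI[where x = "(x, y)"]) auto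
      then show ?thesis ..
    next
      case 2
      then have "P \<in> ?UW" unfolding P(1) by (intro image_eqI[where x = "(y, x)"]) auto
      then show ?thesis ..
    next
      case 3
      then show ?thesis using P by auto
    qed
  qed
  then have "card (link A v) \<le> card (?UW \<union> ?SS)"
    using fin by (intro card_mono) auto
  also have "\<dots> \<le> card ?UW + card ?SS" by (rule card_Un_le)
  also have "\<dots> \<le> (card ?U - 1) * card W + (card S choose 2)"
    using card_pairs_between_le[of "?U - {v}" W] fin v by (simp add: n_subsets)
  finally show ?thesis .
qed

text \<open>Modulo the rationals, \<open>w = -2 * u\<close>, so a pair \<open>x, y\<close> in the link of \<open>w\<close> satisfies \<open>x + y = 2 * u\<close>.
Hence \<open>x\<close> is \<open>u\<close> exactly if \<open>y\<close> is. The two cannot both be \<open>-2 * u\<close>, as \<open>6 * u\<close> is not zero, so a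
pair outside \<open>U\<close> has an element in \<open>S\<close>.\<close>

lemma card_link_le_opposite_coset:
  defines "W \<equiv> coset A (- 2 * u)"
  assumes w: "w \<in> W"
  defines "S \<equiv> A - coset A u - W"
  shows "card (link A w) \<le>
    (card (coset A u) choose 2) + card S * (card W - 1) + (card S choose 2)"
proof -
  let ?U = "coset A u"
  let ?UU = "{P. P \<subseteq> ?U \<and> card P = 2}"
  let ?SW = "(\<lambda>(x, y). {x, y}) ` (S \<times> (W - {w}))"
  let ?SS = "{P. P \<subseteq> S \<and> card P = 2}"
  have fin: "finite ?U" "finite W" "finite S"
    using finA by (auto simp: W_def S_def coset_def)
  have wu: "w - - 2 * u \<in> \<rat>" using w by (simp add: coset_def W_def)
  have partner: "(x \<in> ?U \<longrightarrow> y \<in> ?U) \<and> (x \<in> W \<longrightarrow> y \<notin> W)"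
    if "w + x + y \<in> \<rat>" "x \<in> A" "y \<in> A" for x y
  proof -
    from that(1) wu have q: "w + x + y - (w - - 2 * u) \<in> \<rat>" by (rule Rats_diff)
    have "y - u \<in> \<rat>" if "x - u \<in> \<rat>"
      using Rats_diff[OF q that] by (simp add: algebra_simps)
    moreover have False if "x - - 2 * u \<in> \<rat>" "y - - 2 * u \<in> \<rat>"
    proof -
      have "w + x + y - (w - - 2 * u) - (x - - 2 * u) - (y - - 2 * u) \<in> \<rat>"
        by (rule Rats_diff[OF Rats_diff[OF q that(1)] that(2)])
      then have "- 6 * u / - 2 \<in> \<rat>" by (intro Rats_divide) (simp_all add: algebra_simps)
      with three_mult_irrational show False by simp
    qed
    ultimately show ?thesis using that by (auto simp: coset_def W_def)
  qed
  have "link A w \<subseteq> ?UU \<union> ?SW \<union> ?SS"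
  proof
    fix P assume "P \<in> link A w"
    then obtain x y where P: "P = {x, y}" "x \<noteq> y" "x \<in> A - {w}" "y \<in> A - {w}" "w + x + y \<in> \<rat>"
      by (rule link_pairE)
    have 1: "(x \<in> ?U \<longrightarrow> y \<in> ?U) \<and> (x \<in> W \<longrightarrow> y \<notin> W)"
      using partner[of x y] P by auto
    have 2: "y \<in> ?U \<longrightarrow> x \<in> ?U"
      using partner[of y x] P by (auto simp: ac_simps)
    consider "x \<in> ?U" "y \<in> ?U" | "x \<in> S" "y \<in> W - {w}" | "y \<in> S" "x \<in> W - {w}" | "x \<in> S" "y \<in> S"
      using 1 2 P by (auto simp: S_def)
    then show "P \<in> ?UU \<union> ?SW \<union> ?SS"
    proof cases
      case 1
      then show ?thesis using P by auto
    next
      case 2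
      then have "P \<in> ?SW" unfolding P(1) by (intro image_eqI[where x = "(x, y)"]) auto
      then show ?thesis by blast
    next
      case 3
      then have "P \<in> ?SW" unfolding P(1) by (intro image_eqI[where x = "(y, x)"]) auto
      then show ?thesis by blast
    next
      case 4
      then show ?thesis using P by auto
    qed
  qed
  then have "card (link A w) \<le> card (?UU \<union> ?SW \<union> ?SS)"
    using fin by (intro card_mono) auto
  also have "\<dots> \<le> card ?UU + card ?SW + card ?SS"
    using card_Un_le[of "?UU \<union> ?SW" ?SS] card_Un_le[of ?UU ?SW] by linarith
  also have "\<dots> \<le> (card ?U choose 2) + card S * (card W - 1) + (card S choose 2)"
    using card_pairs_between_le[of S "W - {w}"] fin w by (simp add: n_subsets)
  finally show ?thesis .
qed

end

section \<open>A point of small degree\<close>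

text \<open>The arithmetic behind the point of small degree. In the application the set has \<open>3 * k + e + 1\<close>
elements, of which \<open>m + 1\<close> lie in the largest class \<open>U\<close>, \<open>b\<close> in \<open>W\<close> and \<open>s\<close> in \<open>S\<close>; the increment
to be compared with is \<open>k * (2 * k + e)\<close>. The last three assumptions say that twice this increment
is less than twice the upper bounds for the degrees of an arbitrary point, a point of \<open>U\<close> and a
point of \<open>W\<close>, respectively.

With \<open>d = 2 * k + e - m\<close>, which vanishes for the extremal configuration, the second of these
becomes \<open>s * (2 * m + 1 - s) < 2 * d * (k + e - d)\<close>. This forces \<open>0 < d\<close> and \<open>2 * s \<le> d\<close>, and
with \<open>s\<close> so small the third one fails.\<close>

lemma degree_bounds_incompatible:
  fixes k e m b s :: int
  assumes nonneg: "0 \<le> k" "0 \<le> m" "0 \<le> b" "0 \<le> s"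
    and e: "- 1 \<le> e" "e \<le> 1"
    and size: "m + b + s = 3 * k + e"
    and max_coset: "2 * (k * (2 * k + e)) < (3 * k + e) * (m + 1)"
    and same: "2 * (k * (2 * k + e)) < 2 * (m * b) + s * (s - 1)"
    and opposite: "b \<ge> 1 \<Longrightarrow>
      2 * (k * (2 * k + e)) < (m + 1) * m + 2 * (s * (b - 1)) + s * (s - 1)"
  shows False
proof -
  define d where "d = 2 * k + e - m"
  have m: "m = 2 * k + e - d" and b: "b = k + d - s"
    using size by (auto simp: d_def)
  \<comment> \<open>The first bound excludes a small \<open>U\<close>, which makes the left-hand side of \<open>key\<close> nonnegative.\<close>
  have s_le: "s \<le> 2 * m + 1"
  proof (rule ccontr)
    assume "\<not> s \<le> 2 * m + 1"
    then have mk: "m + 1 \<le> k" using size nonneg e by linarith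
    then have "(3 * k + e) * (m + 1) \<le> (3 * k + e) * k"
      using nonneg e by (intro mult_left_mono) linarith+
    also have "\<dots> \<le> (2 * (2 * k + e)) * k"
    proof (rule mult_right_mono)
      show "3 * k + e \<le> 2 * (2 * k + e)" using mk nonneg e by presburger
    qed (rule nonneg)
    finally show False using max_coset by (simp add: algebra_simps)
  qed
  have key: "s * (2 * m + 1 - s) < 2 * (d * (k + e - d))"
    using same unfolding m b by (simp add: algebra_simps)
  have "0 \<le> s * (2 * m + 1 - s)" using s_le nonneg by simp
  then have "0 < d * (k + e - d)" using key by linarith
  then have cases: "(0 < d \<and> 0 < k + e - d) \<or> (d < 0 \<and> k + e - d < 0)"
    by (simp add: zero_less_mult_iff)
  have "0 \<le> k + d" using b nonneg by linarith
  then have d: "1 \<le> d" "d + 1 \<le> k + e" using cases e by linarith+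
  \<comment> \<open>The left-hand side of \<open>key\<close> is a concave function of \<open>s\<close>. For \<open>d \<le> s\<close> the constraint
    \<open>s \<le> k + d\<close> bounds its second factor from below, for smaller \<open>s\<close> the constraint \<open>s \<le> d - 1\<close>
    gives more.\<close>
  have s_lt: "s < d"
  proof (rule ccontr)
    assume "\<not> s < d"
    then have "d * (2 * k + 2 * e - 2 * d) \<le> s * (2 * m + 1 - s)"
      using d m b nonneg e by (intro mult_mono) linarith+
    with key show False by (simp add: algebra_simps)
  qed
  have s_half: "2 * s \<le> d"
  proof (rule ccontr)
    assume *: "\<not> 2 * s \<le> d"
    have "d * (4 * k + 2 * e - 3 * d + 2) \<le> (2 * s) * (2 * m + 1 - s)"
      using * s_lt d m nonneg e by (intro mult_mono) linarith+
    then have "d * (4 * k + 2 * e - 3 * d + 2) < 4 * (d * (k + e - d))"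
      using key by linarith
    then have "d * (d + 2 - 2 * e) < 0" by (simp add: algebra_simps)
    with d e show False by (simp add: mult_less_0_iff)
  qed
  have "s * (2 * (b - 1) + (s - 1)) \<le> s * (2 * (k + d - 1))"
    using b nonneg by (intro mult_left_mono) simp_all
  also have "\<dots> = (2 * s) * (k + d - 1)" by simp
  finally have *: "s * (2 * (b - 1) + (s - 1)) \<le> (2 * s) * (k + d - 1)" .
  have opp: "2 * (k * (2 * k + e)) < (m + 1) * m + (2 * s) * (k + d - 1)"
  proof -
    have "2 * (k * (2 * k + e)) < (m + 1) * m + 2 * (s * (b - 1)) + s * (s - 1)"
      using opposite b s_lt nonneg by simp
    moreover have "s * (2 * (b - 1) + (s - 1)) = 2 * (s * (b - 1)) + s * (s - 1)"
      by (simp add: algebra_simps)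
    ultimately show ?thesis using * by linarith
  qed
  also have "\<dots> \<le> (m + 1) * m + d * (k + d - 1)"
    using s_half d nonneg by (intro add_left_mono mult_right_mono) linarith+
  finally have fin: "0 < k * (2 * e + 2 - 3 * d) + e * (e + 1 - 2 * d) + 2 * (d * (d - 1))"
    unfolding m by (simp add: algebra_simps)
  \<comment> \<open>What is left is a quadratic inequality in \<open>d\<close>, to be refuted for \<open>1 \<le> d \<le> k + e - 1\<close>.\<close>
  consider "e = - 1" | "e = 0" | "e = 1" using e by linarith
  then show False
  proof cases
    case 1
    then have "0 < d * (2 * d - 3 * k)" using fin by (simp add: algebra_simps)
    with d 1 nonneg show False by (simp add: zero_less_mult_iff)
  next
    case 2
    have "d * (d - 1) \<le> k * (d - 1)" using d 2 by (intro mult_right_mono) linarith+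
    then have "0 < k * (2 - 3 * d) + 2 * (k * (d - 1))" using fin 2 by simp
    then have "k * d < 0" by (simp add: algebra_simps)
    with d nonneg show False by (simp add: mult_less_0_iff)
  next
    case 3
    show False
    proof (cases "d = 1")
      case True
      \<comment> \<open>Here \<open>2 * s\<close> must not be replaced by \<open>d\<close>: at \<open>s = 0\<close> the bound for \<open>W\<close> equals the increment.\<close>
      with s_half nonneg have "s = 0" by linarith
      with opp True 3 show False unfolding m by (simp add: algebra_simps)
    next
      case False
      have "(d - 1) * (d - 1) \<le> (k - 1) * (d - 1)"
        using d 3 by (intro mult_right_mono) linarith+
      moreover have "0 < k * (4 - 3 * d) + 2 * ((d - 1) * (d - 1))"
        using fin 3 by (simp add: algebra_simps)
      ultimately have "0 < k * (4 - 3 * d) + 2 * ((k - 1) * (d - 1))" by linarith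
      then have "0 < k * (2 - d) - 2 * (d - 1)" by (simp add: algebra_simps)
      moreover have "k * (2 - d) \<le> 0"
        using False d nonneg by (simp add: mult_le_0_iff)
      moreover have "0 \<le> 2 * (d - 1)" using d by simp
      ultimately show False by linarith
    qed
  qed
qed

lemma two_choose_two: "2 * int (x choose 2) = int x * (int x - 1)"
proof -
  have "2 * (x choose 2) = x * (x - 1)"
    unfolding choose_two by (intro dvd_mult_div_cancel) (cases "even x"; simp)
  then have "int (2 * (x choose 2)) = int (x * (x - 1))" by presburger
  then show ?thesis by (cases x) (auto simp: algebra_simps)
qed

text \<open>If all degrees exceeded \<open>k * (n - 1 - k)\<close>, then so would the three bounds above, the first two taken
at a point \<open>u\<close> of a largest class and the third at any point of the class of \<open>-2 * u\<close>, if there is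
one.\<close>

lemma exists_small_degree:
  assumes A: "finite A" "A \<inter> \<rat> = {}" and n: "card A = 3 * k + l" "l \<le> 2" "A \<noteq> {}"
  obtains v where "v \<in> A" "card (link A v) \<le> k * (card A - 1 - k)"
proof (rule ccontr)
  assume "\<not> thesis"
  with that have large: "k * (card A - 1 - k) < card (link A v)" if "v \<in> A" for v
    using \<open>v \<in> A\<close> not_less by blast
  obtain u where u: "u \<in> A" and umax: "\<And>x. x \<in> A \<Longrightarrow> card (coset A x) \<le> card (coset A u)"
    using Max_in[of "(\<lambda>x. card (coset A x)) ` A"] Max_ge[of "(\<lambda>x. card (coset A x)) ` A"] A n
    by (smt (verit) finite_imageI image_iff image_is_empty)
  have uirr: "u \<notin> \<rat>" using u A by blast
  define U where "U = coset A u"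
  define W where "W = coset A (- 2 * u)"
  define S where "S = A - U - W"
  have max_coset: "card (coset A c) \<le> card U" for c
  proof (cases "coset A c = {}")
    case False
    then obtain x where x: "x \<in> A" "x - c \<in> \<rat>" by (auto simp: coset_def)
    have "coset A c \<subseteq> coset A x"
    proof
      fix y assume "y \<in> coset A c"
      then have "y \<in> A" and y: "y - c \<in> \<rat>" by (auto simp: coset_def)
      moreover have "y - c - (x - c) = y - x" by simp
      ultimately have "y \<in> A" "y - x \<in> \<rat>" using Rats_diff[OF y x(2)] by simp_all
      then show "y \<in> coset A x" by (auto simp: coset_def)
    qed
    then have "card (coset A c) \<le> card (coset A x)" by (intro card_mono finite_coset A)
    also have "\<dots> \<le> card U" unfolding U_def W_def S_def by (rule umax) (rule x)
    finally show ?thesis .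
  qed simp
  have fin: "finite U" "finite W" "finite S"
    using A by (auto simp: U_def W_def S_def coset_def)
  have uU: "u \<in> U" using u by (simp add: U_def W_def S_def coset_def)
  have "A = U \<union> W \<union> S" by (auto simp: U_def W_def S_def coset_def)
  moreover have "U \<inter> W = {}" unfolding U_def W_def S_def by (rule coset_disjoint[OF A(1) uirr])
  moreover have "(U \<union> W) \<inter> S = {}" by (auto simp: U_def W_def S_def)
  ultimately have cardA: "card A = card U + card W + card S"
    using fin by (simp add: card_Un_disjoint)
  have U1: "1 \<le> card U" using uU fin by (simp add: Suc_le_eq card_gt_0_iff) blast
  have A1: "1 \<le> card A" using cardA U1 by linarith
  define K where "K = int k * (2 * int k + (int l - 1))"
  have "int (card A - 1 - k) = 2 * int k + (int l - 1)"
    using n A1 by linarith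
  then have K: "K < int (card (link A v))" if "v \<in> A" for v
    using large[OF that] unfolding K_def by (metis of_nat_less_iff of_nat_mult)
  show False
  proof (rule degree_bounds_incompatible)
    show "int (card U) - 1 + int (card W) + int (card S) = 3 * int k + (int l - 1)"
      using cardA n by simp
    have "2 * int (card (link A u)) \<le> int ((card A - 1) * card U)"
      using card_link_le_max_coset[OF A(1) u max_coset] by linarith
    also have "int ((card A - 1) * card U)
        = (3 * int k + (int l - 1)) * (int (card U) - 1 + 1)"
      using A1 n by (simp add: of_nat_diff)
    finally show "2 * (int k * (2 * int k + (int l - 1)))
        < (3 * int k + (int l - 1)) * (int (card U) - 1 + 1)"
      using K[OF u] unfolding K_def by linarith
    have "card (link A u) \<le> (card U - 1) * card W + (card S choose 2)"
      using card_link_le_same_coset[OF A(1) uirr] uU unfolding U_def W_def S_def by blast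
    moreover have "int ((card U - 1) * card W) = (int (card U) - 1) * int (card W)"
      using U1 by (simp add: of_nat_diff)
    ultimately show "2 * (int k * (2 * int k + (int l - 1)))
        < 2 * ((int (card U) - 1) * int (card W)) + int (card S) * (int (card S) - 1)"
      using K[OF u] two_choose_two[of "card S"] unfolding K_def by linarith
    assume W1: "1 \<le> int (card W)"
    then obtain w where w: "w \<in> W" by fastforce
    then have wA: "w \<in> A" by (simp add: U_def W_def S_def coset_def)
    have "card (link A w) \<le>
        (card U choose 2) + card S * (card W - 1) + (card S choose 2)"
      using card_link_le_opposite_coset[OF A(1) uirr] w unfolding U_def W_def S_def by blast
    moreover have "int (card S * (card W - 1)) = int (card S) * (int (card W) - 1)"
      using W1 by (simp add: of_nat_diff)
    ultimately show "2 * (int k * (2 * int k + (int l - 1)))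
        < (int (card U) - 1 + 1) * (int (card U) - 1)
          + 2 * (int (card S) * (int (card W) - 1)) + int (card S) * (int (card S) - 1)"
      using K[OF wA] two_choose_two[of "card S"] two_choose_two[of "card U"]
      unfolding K_def by (simp only: diff_add_cancel)
  qed (use U1 n in auto)
qed

section \<open>The maximum\<close>

text \<open>When \<open>n\<close> is a multiple of 3, the step from \<open>n - 1\<close> to \<open>n\<close> raises the first factor by one and leaves
the binomial coefficient unchanged; otherwise the upper entry of the binomial coefficient grows by
one and the first factor stays. The increment has the same form in both cases.\<close>

lemma choose_recurrence:
  fixes n :: nat
  assumes "0 < n"
  shows "(n div 3) * ((n - n div 3) choose 2) =
    ((n - 1) div 3) * ((n - 1 - (n - 1) div 3) choose 2) + (n div 3) * (n - 1 - n div 3)"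
proof (cases "n mod 3 = 0")
  case True
  with assms obtain j where n: "n = 3 * Suc j"
    by (metis dvd_def mod_0_imp_dvd mult_0_right not0_implies_Suc not_gr_zero)
  have "(n - 1) div 3 = j" "n div 3 = Suc j" unfolding n by presburger+
  moreover have "2 * (Suc (Suc (2 * j)) choose 2) = 2 * (Suc (2 * j) * Suc j)"
    by (simp add: choose_two)
  ultimately show ?thesis unfolding n by (simp add: algebra_simps)
next
  case False
  then have "(n - 1) div 3 = n div 3" by presburger
  moreover have "n - n div 3 = Suc (n - 1 - n div 3)" using assms by presburger
  moreover have "Suc x choose 2 = (x choose 2) + x" for x
    by (simp add: numeral_2_eq_2)
  ultimately show ?thesis by (simp only: distrib_left)
qed

lemma card_rational_triples_le:
  assumes "finite A" "A \<inter> \<rat> = {}"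
  shows "card (rational_sums A 3) \<le> (card A div 3) * ((card A - card A div 3) choose 2)"
  using assms
proof (induction "card A" arbitrary: A)
  case 0
  then have "rational_sums A 3 = {}" by (auto simp: rational_sums_def)
  then show ?case by simp
next
  case (Suc m)
  let ?k = "card A div 3"
  have "card A = 3 * ?k + card A mod 3" "card A mod 3 \<le> 2" "A \<noteq> {}"
    using Suc.hyps(2) by auto
  then obtain v where v: "v \<in> A" and deg: "card (link A v) \<le> ?k * (card A - 1 - ?k)"
    using exists_small_degree[OF Suc.prems] by metis
  have card: "card (A - {v}) = card A - 1" using v Suc.prems by simp
  have "card (rational_sums A 3) = card (rational_sums (A - {v}) 3) + card (link A v)"
    by (rule card_rational_sums_remove) (use v Suc.prems in auto)
  also have "\<dots> \<le> ((card A - 1) div 3) * ((card A - 1 - (card A - 1) div 3) choose 2)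
      + ?k * (card A - 1 - ?k)"
  proof (intro add_mono deg)
    have "m = card (A - {v})" "finite (A - {v})" "(A - {v}) \<inter> \<rat> = {}"
      using card Suc.prems Suc.hyps(2) by auto
    from Suc.hyps(1)[OF this] show "card (rational_sums (A - {v}) 3)
        \<le> ((card A - 1) div 3) * ((card A - 1 - (card A - 1) div 3) choose 2)"
      unfolding card .
  qed
  also have "\<dots> = ?k * ((card A - ?k) choose 2)"
    using Suc.hyps(2) by (intro choose_recurrence[symmetric]) simp
  finally show ?case .
qed

text \<open>The two classes are populated by integer translates. They are disjoint because \<open>3 * a\<close> is
irrational, so a triple with one point in \<open>X\<close> and two in \<open>Y\<close> determines these parts.\<close>

lemma exists_many_rational_triples:
  obtains A where "A \<in> irrational_sets (k + m)" "k * (m choose 2) \<le> card (rational_sums A 3)"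
proof -
  obtain B where "B \<in> irrational_sets 1" using irrational_sets_nonempty[of 1] by blast
  then have "B \<noteq> {}" "B \<inter> \<rat> = {}" by (auto simp: irrational_sets_def)
  then obtain a :: real where a: "a \<notin> \<rat>" by blast
  define f where "f i = real i - 2 * a" for i :: nat
  define g where "g j = real j + a" for j :: nat
  define X where "X = f ` {..<k}"
  define Y where "Y = g ` {..<m}"
  let ?T = "X \<times> {P. P \<subseteq> Y \<and> card P = 2}"
  have f_irr: "f i \<notin> \<rat>" for i
  proof
    assume "f i \<in> \<rat>"
    then have "(real i - f i) / 2 \<in> \<rat>"
      by (rule Rats_divide[OF Rats_diff[OF Rats_of_nat] Rats_number_of])
    with a show False by (simp add: f_def)
  qed
  have g_irr: "g j \<notin> \<rat>" for j
    using a Rats_diff[of "g j" "real j"] by (auto simp: g_def)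
  have f_g: "f i \<noteq> g j" for i j
  proof
    assume "f i = g j"
    then have "a = (real i - real j) / 3" by (simp add: f_def g_def)
    also have "\<dots> \<in> \<rat>"
      by (rule Rats_divide[OF Rats_diff[OF Rats_of_nat Rats_of_nat] Rats_number_of])
    finally show False using a by simp
  qed
  have card: "card X = k" "card Y = m"
    by (auto simp: X_def Y_def f_def g_def card_image inj_on_def)
  have fin: "finite X" "finite Y" by (auto simp: X_def Y_def)
  have disj: "X \<inter> Y = {}" using f_g unfolding X_def Y_def by blast
  have "card (X \<union> Y) = k + m"
    using card_Un_disjoint[OF fin disj] card by simp
  moreover have "(X \<union> Y) \<inter> \<rat> = {}"
    using f_irr g_irr unfolding X_def Y_def by blast
  ultimately have "X \<union> Y \<in> irrational_sets (k + m)"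
    using fin by (simp add: irrational_sets_def)
  moreover have "k * (m choose 2) \<le> card (rational_sums (X \<union> Y) 3)"
  proof -
    have "inj_on (\<lambda>(x, P). insert x P) ?T"
    proof (rule inj_onI, clarify)
      fix x P x' P'
      assume "x \<in> X" "x' \<in> X" "P \<subseteq> Y" "P' \<subseteq> Y" and eq: "insert x P = insert x' P'"
      then have "{x} = insert x P \<inter> X" "{x'} = insert x' P' \<inter> X"
          "P = insert x P \<inter> Y" "P' = insert x' P' \<inter> Y"
        using disj by auto
      with eq show "x = x' \<and> P = P'" by (metis singleton_inject)
    qed
    then have "k * (m choose 2) = card ((\<lambda>(x, P). insert x P) ` ?T)"
      using fin card by (simp add: card_image card_cartesian_product n_subsets)
    also have "\<dots> \<le> card (rational_sums (X \<union> Y) 3)"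
    proof (rule card_mono)
      show "finite (rational_sums (X \<union> Y) 3)"
        by (rule finite_subset[of _ "Pow (X \<union> Y)"]) (use fin in \<open>auto simp: rational_sums_def\<close>)
      show "(\<lambda>(x, P). insert x P) ` ?T \<subseteq> rational_sums (X \<union> Y) 3"
      proof clarify
        fix x P assume x: "x \<in> X" and P: "P \<subseteq> Y" "card P = 2"
        obtain y z where yz: "P = {y, z}" "y \<noteq> z" using P(2) by (auto simp: card_2_iff)
        obtain i j j' where "x = f i" "y = g j" "z = g j'"
          using x P yz by (auto simp: X_def Y_def)
        moreover from this have "x + (y + z) = real (i + j + j')" by (simp add: f_def g_def)
        ultimately show "insert x P \<in> rational_sums (X \<union> Y) 3"
          using x P yz f_g by (auto simp: rational_sums_def)
      qed
    qed
    finally show ?thesis .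
  qed
  ultimately show thesis by (rule that)
qed

theorem theorem1p6:
  fixes n k l :: nat
  assumes "n = 3 * k + l" and "l \<le> 2"
  shows "h n 3 = k * ((2 * k + l) choose 2)"
proof -
  have k: "n div 3 = k" "n - k = 2 * k + l" "n = k + (2 * k + l)" using assms by auto
  have upper: "card (rational_sums A 3) \<le> k * ((2 * k + l) choose 2)"
    if "A \<in> irrational_sets n" for A
    using card_rational_triples_le[of A] that k by (auto simp: irrational_sets_def)
  obtain A where "A \<in> irrational_sets n" "k * ((2 * k + l) choose 2) \<le> card (rational_sums A 3)"
    using exists_many_rational_triples[of k "2 * k + l"] k(3) by metis
  with upper have "k * ((2 * k + l) choose 2) \<in> (\<lambda>A. card (rational_sums A 3)) ` irrational_sets n"
    by (metis antisym image_eqI)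
  then show ?thesis
    unfolding h_def using upper by (intro Max_eqI finite_card_rational_sums) auto
qed

end
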